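(* Let $G=(V_G,E_G)$ and $H=(V_H,E_H)$ be finite simple connected graphs with $|V_G|=n$ and $|V_H|=m$. Then $$Sz(G\wr H)=n^3m^{3n-3}Sz(H)+m^n\sum_{A,B\subseteq V_G}(m-1)^{|A|+|B|}\,Sz(G,A,B).$$
   Context: The wreath product $G\wr H$ has vertex set $\{(f,v): f:V_G\to V_H,\ v\in V_G\}$; $(f,v)$ and $(f',v')$ are adjacent iff either $v=v'$, $f(w)=f'(w)$ for $w\neq v$ and $f(v)\sim f'(v)$ in $H$, or $f=f'$ and $v\sim v'$ in $G$. For a connected graph $X$ and edge $e=\{u,v\}$, $n_u(e)=|\{w\in V_X:d_X(w,u)<d_X(w,v)\}|$ and the Szeged index is $Sz(X)=\sum_{e=\{u,v\}\in E_X}n_u(e)n_v(e)$. For $A\subseteq V_G$ and $x,x'\in V_G$, $\rho_A(x,x')$ is the minimum length of a walk in $G$ from $x$ to $x'$ (vertex repetitions allowed, length $\ge0$) visiting every vertex of $A$. For $e=\{x_j,x_k\}\in E_G$, $n_{x_j}(e,\rho_A)=|\{x\in V_G:\rho_A(x,x_j)<\rho_A(x,x_k)\}|$ and symmetrically for $x_k$. For $A,B\subseteq V_G$, $Sz(G,A,B)=\sum_{e=\{x_j,x_k\}\in E_G}n_{x_j}(e,\rho_A)\,n_{x_k}(e,\rho_B)$, each edge written once with a fixed choice of which endpoint is $x_j$. The convention $0^0=1$ is used. *)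

theory Defs
  imports "Graph_Theory.Graph_Theory" "HOL-Library.FuncSet"
begin

text \<open>
  A finite simple graph is a \<^locale>\<open>pair_graph\<close>: a finite, loop-free, symmetric digraph without
  parallel arcs. An undirected edge \<open>{u, v}\<close> is thus a pair of opposite arcs, and it is
  represented by its set of endpoints, so that every edge is counted once.
\<close>

definition uedges :: "'a pair_pre_digraph \<Rightarrow> 'a set set" where
  "uedges X = {{u, v} | u v. (u, v) \<in> parcs X}"

definition gdist :: "'a pair_pre_digraph \<Rightarrow> 'a \<Rightarrow> 'a \<Rightarrow> nat" where
  "gdist X u v = (LEAST k. \<exists>p. pre_digraph.awalk (with_proj X) u p v \<and> length p = k)"

text \<open>
  \<open>n\<^sub>u(e)\<close> for an edge \<open>e = {u, v}\<close>; the bounded quantifier ranges over the single vertex \<open>v\<close>.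
\<close>

definition szeged_n :: "'a pair_pre_digraph \<Rightarrow> 'a set \<Rightarrow> 'a \<Rightarrow> nat" where
  "szeged_n X e u = card {w \<in> pverts X. \<forall>v \<in> e - {u}. gdist X w u < gdist X w v}"

definition szeged :: "'a pair_pre_digraph \<Rightarrow> nat" where
  "szeged X = (\<Sum>e \<in> uedges X. \<Prod>u \<in> e. szeged_n X e u)"

definition rho :: "'a pair_pre_digraph \<Rightarrow> 'a set \<Rightarrow> 'a \<Rightarrow> 'a \<Rightarrow> nat" where
  "rho G A x y = (LEAST k. \<exists>p. pre_digraph.awalk (with_proj G) x p y
      \<and> A \<subseteq> set (pre_digraph.awalk_verts (with_proj G) x p) \<and> length p = k)"

definition szeged_n_rho :: "'a pair_pre_digraph \<Rightarrow> 'a set \<Rightarrow> 'a set \<Rightarrow> 'a \<Rightarrow> nat" where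
  "szeged_n_rho G A e u = card {x \<in> pverts G. \<forall>v \<in> e - {u}. rho G A x u < rho G A x v}"

text \<open>
  A choice, for every edge, of which endpoint is written first. The summands of \<open>Sz(G, A, B)\<close>
  are not symmetric in the two endpoints, so \<open>Sz(G, A, B)\<close> depends on this choice.
\<close>

definition orientation :: "'a pair_pre_digraph \<Rightarrow> 'a rel \<Rightarrow> bool" where
  "orientation G D \<longleftrightarrow> D \<subseteq> parcs G \<and> (\<forall>(u, v) \<in> parcs G. (u, v) \<in> D \<longleftrightarrow> (v, u) \<notin> D)"

definition szeged_rho :: "'a pair_pre_digraph \<Rightarrow> 'a rel \<Rightarrow> 'a set \<Rightarrow> 'a set \<Rightarrow> nat" where
  "szeged_rho G D A B = (\<Sum>(x, y) \<in> D. szeged_n_rho G A {x, y} x * szeged_n_rho G B {x, y} y)"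

text \<open>
  Functions \<open>V\<^sub>G \<rightarrow> V\<^sub>H\<close> are the extensional ones, so that each is represented exactly once.
\<close>

definition wreath :: "'a pair_pre_digraph \<Rightarrow> 'b pair_pre_digraph
    \<Rightarrow> (('a \<Rightarrow> 'b) \<times> 'a) pair_pre_digraph" where
  "wreath G H = (let V = (pverts G \<rightarrow>\<^sub>E pverts H) \<times> pverts G in
     \<lparr> pverts = V,
       parcs = {((f, v), (f', v')) | f v f' v'. (f, v) \<in> V \<and> (f', v') \<in> V \<and>
         (v = v' \<and> (\<forall>w \<in> pverts G. w \<noteq> v \<longrightarrow> f w = f' w) \<and> (f v, f' v) \<in> parcs H
          \<or> f = f' \<and> (v, v') \<in> parcs G)} \<rparr>)"

lemma gdist_eq_\<mu>:
  assumes "pair_graph X" "connected (with_proj X)" "u \<in> pverts X" "v \<in> pverts X"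
  shows "wf_digraph.\<mu> (with_proj X) (\<lambda>_. 1) u v = ereal (real (gdist X u v))"
proof -
  interpret pair_graph X by fact
  have cost: "awalk_cost (\<lambda>_. 1) p = real (length p)" for p :: "('a \<times> 'a) list"
    by (induction p) auto
  have "strongly_connected (with_proj X)"
    using assms(2) symmetric_connected_imp_strongly_connected[OF pair_sym_arcs] by simp
  then have "u \<rightarrow>\<^sup>*\<^bsub>with_proj X\<^esub> v"
    using assms(3,4) unfolding strongly_connected_def by simp
  then obtain p where "awalk u p v"
    by (auto simp: reachable_awalk)
  then have ex: "\<exists>k p. awalk u p v \<and> length p = k"
    by blast
  obtain p where p: "awalk u p v" "length p = gdist X u v"
    using LeastI_ex[OF ex] unfolding gdist_def by blast
  have le: "gdist X u v \<le> length q" if "awalk u q v" for q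
    unfolding gdist_def by (rule Least_le) (use that in blast)
  show ?thesis
    unfolding \<mu>_def
  proof (rule INF_eqI)
    fix q assume "q \<in> {q. awalk u q v}"
    then show "ereal (real (gdist X u v)) \<le> ereal (awalk_cost (\<lambda>_. 1) q)"
      using le by (simp add: cost)
  next
    fix y assume "\<And>q. q \<in> {q. awalk u q v} \<Longrightarrow> y \<le> ereal (awalk_cost (\<lambda>_. 1) q)"
    from this[of p] show "y \<le> ereal (real (gdist X u v))"
      using p by (simp add: cost)
  qed
qed

lemma (in pair_graph) szeged_n_edge:
  assumes "(u, v) \<in> parcs G"
  shows "szeged_n G {u, v} u = card {w \<in> pverts G. gdist G w u < gdist G w v}"
    and "(\<Prod>w \<in> {u, v}. szeged_n G {u, v} w) = szeged_n G {u, v} u * szeged_n G {u, v} v"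
    and "szeged_n_rho G A {u, v} u = card {x \<in> pverts G. rho G A x u < rho G A x v}"
  using pair_no_loops[OF assms] by (auto simp: szeged_n_def szeged_n_rho_def insert_Diff_if)

lemma pair_graph_wreath:
  assumes "pair_graph G" "pair_graph H"
  shows "pair_graph (wreath G H)"
proof -
  interpret G: pair_graph G by fact
  interpret H: pair_graph H by fact
  have fin: "finite (pverts (wreath G H))"
    by (auto simp: wreath_def Let_def intro!: finite_PiE G.pair_finite_verts H.pair_finite_verts)
  have "parcs (wreath G H) \<subseteq> pverts (wreath G H) \<times> pverts (wreath G H)"
    by (auto simp: wreath_def Let_def)
  then have "finite (parcs (wreath G H))"
    using fin by (meson finite_SigmaI finite_subset)
  moreover have "symmetric (with_proj (wreath G H))"
    using G.pair_sym_arcs H.pair_sym_arcs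
    unfolding symmetric_def sym_def by (auto simp: wreath_def Let_def)
  ultimately show ?thesis
    using fin
    by unfold_locales (auto simp: wreath_def Let_def dest: G.pair_no_loops H.pair_no_loops)
qed

end

theory Submission
  imports Defs
begin

text \<open>
  Moving from \<open>(f, v)\<close> to \<open>(g, w)\<close> in the wreath product means walking in \<open>G\<close> from \<open>v\<close> to \<open>w\<close>
  through every coordinate \<open>x\<close> with \<open>f x \<noteq> g x\<close>, and changing \<open>f x\<close> into \<open>g x\<close> by a walk in \<open>H\<close>
  while standing at \<open>x\<close>. The distance is therefore \<open>\<rho>\<^sub>A(v, w) + \<Sum>x. d\<^sub>H(f x, g x)\<close>, where \<open>A\<close> is the
  set of differing coordinates. Along an edge that changes \<open>f v\<close> the term \<open>\<rho>\<^sub>A\<close> is constant, because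
  every walk ending in \<open>v\<close> visits \<open>v\<close>; such edges contribute the multiple of \<open>Sz(H)\<close>. Along an edge
  that changes \<open>v\<close> the sum is constant, and grouping the vertices \<open>(g, x)\<close> by \<open>A\<close>, with
  \<open>(m - 1) ^ |A|\<close> choices of \<open>g\<close> for each \<open>A\<close>, gives the double sum over \<open>A\<close> and \<open>B\<close>. Every sum
  over edges is computed as half a sum over arcs.
\<close>

section \<open>Walks and covering walks in a connected graph\<close>

locale connected_graph = pair_graph +
  assumes connected_proj: "connected (with_proj G)"
begin

lemma awalk_exists:
  assumes "u \<in> pverts G" "v \<in> pverts G"
  shows "\<exists>p. awalk u p v"
proof -
  have "strongly_connected (with_proj G)"
    using connected_proj symmetric_connected_imp_strongly_connected[OF pair_sym_arcs] by simp
  then have "u \<rightarrow>\<^sup>*\<^bsub>with_proj G\<^esub> v"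
    using assms unfolding strongly_connected_def by simp
  then show ?thesis
    by (auto simp: reachable_awalk)
qed

text \<open>Visit the elements of \<open>A\<close> one after another along arbitrary connecting
  walks; the start vertex is generalised because each leg begins where the previous one ended. This
  makes the \<open>LEAST\<close> in \<open>rho\<close> an attained minimum.\<close>

lemma covering_awalk_exists:
  assumes "finite A" "A \<subseteq> pverts G" "u \<in> pverts G" "v \<in> pverts G"
  shows "\<exists>p. awalk u p v \<and> A \<subseteq> set (awalk_verts u p)"
  using assms
proof (induction A arbitrary: u rule: finite_induct)
  case empty
  then show ?case using awalk_exists by simp
next
  case (insert a A)
  obtain q where q: "awalk a q v" "A \<subseteq> set (awalk_verts a q)"
    using insert.IH[of a] insert.prems by auto
  obtain p where p: "awalk u p a"
    using awalk_exists[of u a] insert.prems by auto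
  have pq: "awalk u (p @ q) v"
    using p q(1) by (rule awalk_appendI)
  have "set (awalk_verts u (p @ q)) = set (awalk_verts u p) \<union> set (awalk_verts a q)"
    using set_awalk_verts_append[OF p q(1)] .
  moreover have "a \<in> set (awalk_verts a q)"
    using q(1) by (cases q) (auto simp: awalk_Cons_iff)
  ultimately have "insert a A \<subseteq> set (awalk_verts u (p @ q))"
    using q(2) by blast
  with pq show ?case by blast
qed

lemma gdist_attained:
  assumes "u \<in> pverts G" "v \<in> pverts G"
  obtains p where "awalk u p v" "length p = gdist G u v"
proof -
  have "\<exists>k p. awalk u p v \<and> length p = k"
    using awalk_exists[OF assms] by blast
  from LeastI_ex[OF this] show ?thesis
    using that unfolding gdist_def by blast
qed

lemma gdist_le: "awalk u p v \<Longrightarrow> gdist G u v \<le> length p"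
  unfolding gdist_def by (rule Least_le) blast

lemma gdist_self: "u \<in> pverts G \<Longrightarrow> gdist G u u = 0"
  using gdist_le[of u "[]" u] by (simp add: awalk_Nil_iff)

lemma gdist_arc_le:
  assumes "(u, u') \<in> parcs G" "v \<in> pverts G"
  shows "gdist G u v \<le> Suc (gdist G u' v)"
proof -
  have "u' \<in> pverts G" using assms(1) in_arcsD2 by simp
  then obtain p where p: "awalk u' p v" "length p = gdist G u' v"
    using gdist_attained assms(2) by blast
  have "awalk u ((u, u') # p) v"
    using p assms(1) by (auto simp: awalk_Cons_iff)
  from gdist_le[OF this] p show ?thesis by simp
qed

lemma rho_attained:
  assumes "A \<subseteq> pverts G" "u \<in> pverts G" "v \<in> pverts G"
  obtains p where "awalk u p v" "A \<subseteq> set (awalk_verts u p)" "length p = rho G A u v"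
proof -
  have "finite A"
    using assms(1) pair_finite_verts finite_subset by blast
  then have "\<exists>k p. awalk u p v \<and> A \<subseteq> set (awalk_verts u p) \<and> length p = k"
    using covering_awalk_exists assms by blast
  from LeastI_ex[OF this] show ?thesis
    using that unfolding rho_def awalk_verts_with_proj_eq by blast
qed

lemma rho_le: "awalk u p v \<Longrightarrow> A \<subseteq> set (awalk_verts u p) \<Longrightarrow> rho G A u v \<le> length p"
  unfolding rho_def awalk_verts_with_proj_eq by (rule Least_le) blast

text \<open>A walk contains its last vertex, so membership of \<open>v\<close> in the set imposes no
  condition. This keeps the \<open>rho\<close> term fixed when a function changes its value at
  \<open>v\<close>.\<close>

lemma rho_cong_endpoint:
  assumes "A - {v} = B - {v}"
  shows "rho G A u v = rho G B u v"
proof -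
  have "A \<subseteq> set (awalk_verts u p) \<longleftrightarrow> B \<subseteq> set (awalk_verts u p)" if "awalk u p v" for p
  proof -
    have "v \<in> set (awalk_verts u p)"
      using that by (metis awlast_of_awalk NOMATCH_def awalk_verts_non_Nil last_in_set)
    then show ?thesis using assms by blast
  qed
  then have "(\<lambda>k. \<exists>p. awalk u p v \<and> A \<subseteq> set (awalk_verts u p) \<and> length p = k)
           = (\<lambda>k. \<exists>p. awalk u p v \<and> B \<subseteq> set (awalk_verts u p) \<and> length p = k)"
    by blast
  then show ?thesis unfolding rho_def awalk_verts_with_proj_eq by simp
qed

end

section \<open>Sums over edges as sums over arcs\<close>

lemma (in pair_graph) sum_arcs_eq_double_sum_uedges:
  fixes F :: "'a \<Rightarrow> 'a \<Rightarrow> nat"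
  shows "(\<Sum>(u, v) \<in> parcs G. F u v * F v u) = 2 * (\<Sum>e \<in> uedges G. \<Prod>u \<in> e. \<Prod>v \<in> e - {u}. F u v)"
proof -
  have img: "(\<lambda>(u, v). {u, v}) ` parcs G = uedges G"
    by (auto simp: uedges_def image_def split: prod.splits)
  have "(\<Sum>(u, v) \<in> parcs G. F u v * F v u)
      = (\<Sum>e \<in> uedges G. \<Sum>(u, v) \<in> {a \<in> parcs G. (case a of (u, v) \<Rightarrow> {u, v}) = e}. F u v * F v u)"
    unfolding img[symmetric] by (rule sum.image_gen) (rule pair_finite_arcs)
  also have "\<dots> = (\<Sum>e \<in> uedges G. 2 * (\<Prod>u \<in> e. \<Prod>v \<in> e - {u}. F u v))"
  proof (rule sum.cong[OF refl])
    fix e assume "e \<in> uedges G"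
    then obtain u v where e: "e = {u, v}" "(u, v) \<in> parcs G"
      by (auto simp: uedges_def)
    have "(v, u) \<in> parcs G"
      using e(2) pair_sym_arcs by (auto simp: symmetric_def sym_def)
    have "u \<noteq> v" using pair_no_loops[OF e(2)] by simp
    have "a \<in> parcs G \<and> (case a of (u, v) \<Rightarrow> {u, v}) = e \<longleftrightarrow> a = (u, v) \<or> a = (v, u)" for a
      using e(2) \<open>(v, u) \<in> parcs G\<close> by (cases a) (auto simp: e(1) doubleton_eq_iff)
    then have "{a \<in> parcs G. (case a of (u, v) \<Rightarrow> {u, v}) = e} = {(u, v), (v, u)}"
      by (simp only: set_eq_iff mem_Collect_eq insert_iff empty_iff simp_thms)
    \<comment> \<open>Since the endpoints are distinct, each inner product has a single factor, and
      the nested product is \<open>F u v * F v u\<close> without a choice of order. Both arcs of the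
      edge contribute this value.\<close>
    then show "(\<Sum>(u, v) \<in> {a \<in> parcs G. (case a of (u, v) \<Rightarrow> {u, v}) = e}. F u v * F v u)
        = 2 * (\<Prod>u \<in> e. \<Prod>v \<in> e - {u}. F u v)"
      using \<open>u \<noteq> v\<close> by (simp add: e(1) insert_Diff_if)
  qed
  finally show ?thesis by (simp add: sum_distrib_left)
qed

text \<open>Counts for ordered pairs, so that they can be summed over arcs. On the endpoints of an
  edge they agree with \<open>szeged_n\<close>, and those of \<open>closer_rho\<close> with
  \<open>szeged_n_rho\<close>.\<close>

definition closer :: "'a pair_pre_digraph \<Rightarrow> 'a \<Rightarrow> 'a \<Rightarrow> nat" where
  "closer X u v = card {w \<in> pverts X. gdist X w u < gdist X w v}"

definition closer_rho :: "'a pair_pre_digraph \<Rightarrow> 'a set \<Rightarrow> 'a \<Rightarrow> 'a \<Rightarrow> nat" where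
  "closer_rho X A u v = card {w \<in> pverts X. rho X A w u < rho X A w v}"

lemma (in pair_graph) double_szeged:
  "2 * szeged G = (\<Sum>(u, v) \<in> parcs G. closer G u v * closer G v u)"
proof -
  have "(\<Prod>u \<in> e. szeged_n G e u) = (\<Prod>u \<in> e. \<Prod>v \<in> e - {u}. closer G u v)" if edge: "e \<in> uedges G" for e
  proof -
    obtain u v where e: "e = {u, v}" "(u, v) \<in> parcs G"
      using edge by (auto simp: uedges_def)
    have "u \<noteq> v" using pair_no_loops[OF e(2)] by simp
    then show ?thesis
      by (simp add: e(1) insert_Diff_if szeged_n_def closer_def)
  qed
  then show ?thesis
    unfolding sum_arcs_eq_double_sum_uedges szeged_def by simp
qed

text \<open>An orientation keeps one arc of each opposite pair, so \<open>parcs G\<close> is the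
  disjoint union of \<open>D\<close> and its converse, on which a symmetric \<open>F\<close> has
  equal sums.\<close>

lemma (in pair_graph) sum_arcs_eq_double_sum_orientation:
  fixes F :: "'a \<Rightarrow> 'a \<Rightarrow> nat"
  assumes D: "orientation G D" and sym: "\<And>u v. F u v = F v u"
  shows "(\<Sum>(u, v) \<in> parcs G. F u v) = 2 * (\<Sum>(u, v) \<in> D. F u v)"
proof -
  have swap: "(v, u) \<in> parcs G" if "(u, v) \<in> parcs G" for u v
    using that pair_sym_arcs by (auto simp: symmetric_def sym_def)
  have "parcs G = D \<union> D\<inverse>" "D \<inter> D\<inverse> = {}"
    using D swap unfolding orientation_def by auto
  moreover have "finite D"
    using D pair_finite_arcs finite_subset unfolding orientation_def by blast
  moreover have "(\<Sum>(u, v) \<in> D\<inverse>. F u v) = (\<Sum>(u, v) \<in> D. F u v)"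
    by (rule sum.reindex_bij_witness[of _ prod.swap prod.swap]) (auto simp: sym)
  ultimately show ?thesis
    by (simp add: sum.union_disjoint)
qed

section \<open>Counting functions by their coordinates\<close>

lemma sum_PiE_coordinate:
  fixes \<phi> :: "'b \<Rightarrow> nat"
  assumes "finite I" "i \<in> I" "finite S"
  shows "(\<Sum>f \<in> I \<rightarrow>\<^sub>E S. \<phi> (f i)) = card S ^ (card I - 1) * (\<Sum>a \<in> S. \<phi> a)"
proof -
  \<comment> \<open>Factors 1 at the other coordinates turn the summand into a product over
    \<open>I\<close>, so that sum and product can be interchanged.\<close>
  have "(\<Sum>f \<in> I \<rightarrow>\<^sub>E S. \<phi> (f i)) = (\<Sum>f \<in> I \<rightarrow>\<^sub>E S. \<Prod>j\<in>I. if j = i then \<phi> (f j) else 1)"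
    using assms by simp
  also have "\<dots> = (\<Prod>j\<in>I. \<Sum>a\<in>S. if j = i then \<phi> a else 1)"
    using assms by (simp add: prod_sum_PiE)
  also have "\<dots> = (\<Sum>a \<in> S. \<phi> a) * (\<Prod>j\<in>I - {i}. \<Sum>a\<in>S. if j = i then \<phi> a else 1)"
    using assms by (simp add: prod.remove)
  also have "(\<Prod>j\<in>I - {i}. \<Sum>a\<in>S. if j = i then \<phi> a else 1) = (\<Prod>j\<in>I - {i}. card S)"
    by (rule prod.cong) auto
  finally show ?thesis
    using assms by simp
qed

lemma card_PiE_coordinate:
  assumes "finite I" "i \<in> I" "finite S"
  shows "card {f \<in> I \<rightarrow>\<^sub>E S. P (f i)} = card S ^ (card I - 1) * card {a \<in> S. P a}"
proof -
  have fin: "finite (I \<rightarrow>\<^sub>E S)" using assms by (simp add: finite_PiE)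
  have "card {f \<in> I \<rightarrow>\<^sub>E S. P (f i)} = (\<Sum>f \<in> I \<rightarrow>\<^sub>E S. if P (f i) then 1 else 0)"
    using fin by (simp add: sum.inter_filter[symmetric])
  also have "\<dots> = card S ^ (card I - 1) * (\<Sum>a \<in> S. if P a then 1 else 0)"
    by (rule sum_PiE_coordinate[OF assms])
  also have "(\<Sum>a \<in> S. if P a then 1 else 0) = card {a \<in> S. P a}"
    using assms by (simp add: sum.inter_filter[symmetric])
  finally show ?thesis .
qed

text \<open>The choices are independent: any value other than \<open>f x\<close> at each
  \<open>x\<close> in \<open>A\<close>, and \<open>f x\<close> elsewhere. If \<open>S\<close> is a
  singleton, the convention \<open>0 ^ 0 = 1\<close> is right, because then only \<open>f\<close>
  itself exists and it differs on the empty set.\<close>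

lemma card_PiE_differing_on:
  assumes "finite I" "finite S" "f \<in> I \<rightarrow>\<^sub>E S" "A \<subseteq> I"
  shows "card {g \<in> I \<rightarrow>\<^sub>E S. {x \<in> I. g x \<noteq> f x} = A} = (card S - 1) ^ card A"
proof -
  have "{g \<in> I \<rightarrow>\<^sub>E S. {x \<in> I. g x \<noteq> f x} = A} = PiE I (\<lambda>x. if x \<in> A then S - {f x} else {f x})"
    using assms(3,4) by (fastforce simp: PiE_iff split: if_splits)
  then have "card {g \<in> I \<rightarrow>\<^sub>E S. {x \<in> I. g x \<noteq> f x} = A}
      = (\<Prod>x\<in>I. if x \<in> A then card S - 1 else 1)"
    using assms by (auto simp: card_PiE card_Diff_singleton PiE_iff intro!: prod.cong)
  also have "\<dots> = (\<Prod>x\<in>I \<inter> A. card S - 1)"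
    using prod.inter_restrict[OF assms(1), symmetric] .
  finally show ?thesis
    using assms(4) by (simp add: Int_absorb1)
qed

section \<open>The distance in the wreath product\<close>

locale wreath_graphs = G: connected_graph G + H: connected_graph H
  for G :: "'a pair_pre_digraph" and H :: "'b pair_pre_digraph"
begin

abbreviation W where "W \<equiv> wreath G H"
abbreviation VF where "VF \<equiv> pverts G \<rightarrow>\<^sub>E pverts H"
abbreviation differ where "differ f g \<equiv> {x \<in> pverts G. f x \<noteq> g x}"

sublocale W: pair_graph W
  by (rule pair_graph_wreath) unfold_locales

lemma verts_W: "pverts W = VF \<times> pverts G"
  by (simp add: wreath_def Let_def)

lemma arcs_W_iff: "((f, v), (f', v')) \<in> parcs W \<longleftrightarrow>
    f \<in> VF \<and> v \<in> pverts G \<and> f' \<in> VF \<and> v' \<in> pverts G \<and>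
    (v = v' \<and> (\<forall>w \<in> pverts G. w \<noteq> v \<longrightarrow> f w = f' w) \<and> (f v, f' v) \<in> parcs H
     \<or> f = f' \<and> (v, v') \<in> parcs G)"
  by (auto simp: wreath_def Let_def)

abbreviation total_gdist where
  "total_gdist f g \<equiv> (\<Sum>x \<in> pverts G. gdist H (f x) (g x))"

lemma total_gdist_split:
  assumes "v \<in> pverts G"
  shows "total_gdist f g = gdist H (f v) (g v) + (\<Sum>x \<in> pverts G - {v}. gdist H (f x) (g x))"
  using assms by (simp add: sum.remove)

text \<open>This gives the lower bound for the distance. An arc that moves the base vertex lengthens
  \<open>q\<close> by one; an arc that changes a value lowers \<open>total_gdist\<close> by at most
  one, and it acts at the current base vertex, which \<open>q\<close> visits.\<close>

lemma wreath_awalk_projects: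
  assumes "W.awalk (f, v) p (g, w)"
  shows "\<exists>q. G.awalk v q w \<and> differ f g \<subseteq> set (G.awalk_verts v q)
    \<and> length q + total_gdist f g \<le> length p"
  using assms
proof (induction p arbitrary: f v)
  case Nil
  then have "f = g" "v = w" "f \<in> VF" "v \<in> pverts G"
    by (auto simp: W.awalk_Nil_iff verts_W)
  moreover have "total_gdist f f = 0"
    using \<open>f \<in> VF\<close> by (auto simp: H.gdist_self PiE_iff)
  ultimately show ?case
    by (intro exI[of _ "[]"]) (auto simp: G.awalk_Nil_iff)
next
  case (Cons e p)
  obtain f' v' where arc: "((f, v), (f', v')) \<in> parcs W" and p: "W.awalk (f', v') p (g, w)"
    using Cons.prems by (cases e) (auto simp: W.awalk_Cons_iff)
  obtain q where q: "G.awalk v' q w" "differ f' g \<subseteq> set (G.awalk_verts v' q)"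
      "length q + total_gdist f' g \<le> length p"
    using Cons.IH[OF p] by blast
  have g: "g \<in> VF" using W.awalk_last_in_verts[OF p] by (simp add: verts_W)
  have fin: "f \<in> VF" "v \<in> pverts G" using arc by (auto simp: arcs_W_iff)
  consider (H) "v = v'" "\<forall>x \<in> pverts G. x \<noteq> v \<longrightarrow> f x = f' x" "(f v, f' v) \<in> parcs H"
    | (G) "f = f'" "(v, v') \<in> parcs G"
    using arc by (auto simp: arcs_W_iff)
  then show ?case
  proof cases
    case H
    have "g v \<in> pverts H" using g fin by auto
    then have "gdist H (f v) (g v) \<le> Suc (gdist H (f' v) (g v))"
      using H.gdist_arc_le H(3) by blast
    moreover have "(\<Sum>x \<in> pverts G - {v}. gdist H (f x) (g x)) = (\<Sum>x \<in> pverts G - {v}. gdist H (f' x) (g x))"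
      using H(2) by (intro sum.cong) auto
    ultimately have "total_gdist f g \<le> Suc (total_gdist f' g)"
      using total_gdist_split[OF fin(2), of f g] total_gdist_split[OF fin(2), of f' g] by simp
    \<comment> \<open>The changed coordinate is the start of the projected walk, so it is covered
      even if \<open>f'\<close> and \<open>g\<close> agree there.\<close>
    moreover have "v \<in> set (G.awalk_verts v q)"
      using G.hd_in_awalk_verts(1) q(1) H(1) by blast
    then have "differ f g \<subseteq> set (G.awalk_verts v q)"
      using q(2) H(1,2) by (smt (verit) mem_Collect_eq subset_iff)
    ultimately show ?thesis
      using q H(1) by (intro exI[of _ q]) auto
  next
    case G
    then show ?thesis
      using q by (intro exI[of _ "(v, v') # q"]) (auto simp: G.awalk_Cons_iff)
  qed
qed

lemma awalk_in_fibre: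
  assumes "H.awalk a p b" "f \<in> VF" "v \<in> pverts G" "f v = a"
  shows "\<exists>q. W.awalk (f, v) q (f(v := b), v) \<and> length q = length p"
  using assms
proof (induction p arbitrary: a f)
  case Nil
  then have "b = f v" by (simp add: H.awalk_Nil_iff)
  then have "f(v := b) = f" by simp
  with Nil show ?case
    by (intro exI[of _ "[]"]) (auto simp: W.awalk_Nil_iff verts_W)
next
  case (Cons e p)
  obtain c where arc: "(a, c) \<in> parcs H" and p: "H.awalk c p b"
    using Cons.prems by (cases e) (auto simp: H.awalk_Cons_iff)
  have c: "c \<in> pverts H" using H.in_arcsD2[OF arc] by simp
  have f': "f(v := c) \<in> VF"
    using Cons.prems(2,3) c by (auto simp: PiE_iff extensional_def)
  \<comment> \<open>A later update at \<open>v\<close> overwrites the earlier one, so the target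
    \<open>f(v := b)\<close> is the same for the shorter walk.\<close>
  obtain q where q: "W.awalk (f(v := c), v) q (f(v := b), v)" "length q = length p"
    using Cons.IH[OF p f' Cons.prems(3) fun_upd_same] unfolding fun_upd_upd by blast
  have "((f, v), (f(v := c), v)) \<in> parcs W"
    using Cons.prems f' arc by (auto simp: arcs_W_iff)
  then show ?case
    using q by (intro exI[of _ "((f, v), (f(v := c), v)) # q"]) (simp add: W.awalk_Cons_iff del: fun_upd_apply)
qed

text \<open>This gives the upper bound: at each vertex of \<open>q\<close>, correct the value along
  a shortest walk in \<open>H\<close>, then move on. A repeated visit costs nothing more, since the
  value is already right.\<close>

lemma awalk_lifts_to_wreath:
  assumes "G.awalk v q w" "f \<in> VF" "g \<in> VF" "differ f g \<subseteq> set (G.awalk_verts v q)"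
  shows "\<exists>p. W.awalk (f, v) p (g, w) \<and> length p = length q + total_gdist f g"
  using assms
proof (induction q arbitrary: f v)
  case Nil
  then have v: "v = w" "v \<in> pverts G" by (auto simp: G.awalk_Nil_iff)
  have "f v \<in> pverts H" "g v \<in> pverts H" using Nil v by auto
  then obtain r where r: "H.awalk (f v) r (g v)" "length r = gdist H (f v) (g v)"
    using H.gdist_attained by blast
  have eq: "f x = g x" if "x \<in> pverts G" "x \<noteq> v" for x
    using Nil that by auto
  \<comment> \<open>Outside \<open>pverts G\<close> both functions take the same default value
    because they are extensional.\<close>
  have "f(v := g v) = g"
    using Nil.prems(2,3) eq by (intro ext) (metis PiE_arb fun_upd_apply)
  moreover have "(\<Sum>x \<in> pverts G - {v}. gdist H (f x) (g x)) = 0"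
    using eq Nil.prems(3) by (auto simp: H.gdist_self PiE_iff)
  ultimately have "total_gdist f g = length r"
    using r(2) total_gdist_split[OF v(2), of f g] by simp
  moreover obtain p where "W.awalk (f, v) p (g, v)" "length p = length r"
    using awalk_in_fibre[OF r(1) Nil.prems(2) v(2) refl] unfolding \<open>f(v := g v) = g\<close> by blast
  ultimately have "W.awalk (f, v) p (g, w) \<and> length p = length [] + total_gdist f g"
    using v(1) by simp
  then show ?case by blast
next
  case (Cons e q)
  obtain v0 v' where "e = (v0, v')"
    by (cases e)
  then have arc: "(v, v') \<in> parcs G" and q: "G.awalk v' q w" and e: "e = (v, v')"
    using Cons.prems(1) by (simp_all add: G.awalk_Cons_iff)
  have v: "v \<in> pverts G" "v' \<in> pverts G"
    using G.in_arcsD1[OF arc] G.in_arcsD2[OF arc] by simp_all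
  have "f v \<in> pverts H" "g v \<in> pverts H" using Cons.prems v by auto
  then obtain r where r: "H.awalk (f v) r (g v)" "length r = gdist H (f v) (g v)"
    using H.gdist_attained by blast
  let ?f = "f(v := g v)"
  obtain p1 where p1: "W.awalk (f, v) p1 (?f, v)" "length p1 = gdist H (f v) (g v)"
    using awalk_in_fibre[OF r(1) Cons.prems(2) v(1) refl] r(2) by auto
  have f': "?f \<in> VF"
    using Cons.prems(2) v \<open>g v \<in> pverts H\<close> by (auto simp: PiE_iff extensional_def)
  \<comment> \<open>After the correction \<open>v\<close> is no longer a differing coordinate, so
    the rest of the walk covers all that remain.\<close>
  have "differ ?f g \<subseteq> set (G.awalk_verts v' q)"
    using Cons.prems(4) e by (auto split: if_splits)
  then obtain p2 where p2: "W.awalk (?f, v') p2 (g, w)" "length p2 = length q + total_gdist ?f g"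
    using Cons.IH[OF q f' Cons.prems(3)] by blast
  have "((?f, v), (?f, v')) \<in> parcs W"
    using f' v arc by (auto simp: arcs_W_iff)
  then have "W.awalk (?f, v) (((?f, v), (?f, v')) # p2) (g, w)"
    using p2(1) by (auto simp: W.awalk_Cons_iff)
  then have "W.awalk (f, v) (p1 @ ((?f, v), (?f, v')) # p2) (g, w)"
    using p1(1) W.awalk_appendI by blast
  moreover have "total_gdist ?f g = (\<Sum>x \<in> pverts G - {v}. gdist H (f x) (g x))"
    using total_gdist_split[OF v(1), of ?f g] H.gdist_self[OF \<open>g v \<in> pverts H\<close>] by simp
  ultimately show ?case
    using p1(2) p2(2) total_gdist_split[OF v(1), of f g]
    by (intro exI[of _ "p1 @ ((?f, v), (?f, v')) # p2"]) auto
qed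

lemma gdist_wreath:
  assumes "f \<in> VF" "g \<in> VF" "v \<in> pverts G" "w \<in> pverts G"
  shows "gdist W (f, v) (g, w) = rho G (differ f g) v w + total_gdist f g"
proof -
  obtain q where q: "G.awalk v q w" "differ f g \<subseteq> set (G.awalk_verts v q)"
      "length q = rho G (differ f g) v w"
    using G.rho_attained[of "differ f g" v w] assms(3,4) by blast
  obtain p where p: "W.awalk (f, v) p (g, w)" "length p = length q + total_gdist f g"
    using awalk_lifts_to_wreath[OF q(1) assms(1,2) q(2)] by blast
  show ?thesis
    unfolding gdist_def[of W]
  proof (rule Least_equality)
    show "\<exists>p. W.awalk (f, v) p (g, w) \<and> length p = rho G (differ f g) v w + total_gdist f g"
      using p q(3) by auto
  next
    fix k assume "\<exists>p. W.awalk (f, v) p (g, w) \<and> length p = k"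
    then obtain p' where p': "W.awalk (f, v) p' (g, w)" "length p' = k" by blast
    obtain q' where q': "G.awalk v q' w" "differ f g \<subseteq> set (G.awalk_verts v q')"
        "length q' + total_gdist f g \<le> length p'"
      using wreath_awalk_projects[OF p'(1)] by blast
    then show "rho G (differ f g) v w + total_gdist f g \<le> k"
      using G.rho_le[OF q'(1,2)] p'(2) by simp
  qed
qed

section \<open>Vertices closer to one end of an arc\<close>

lemma closer_fibre_arc:
  assumes f: "f \<in> VF" and v: "v \<in> pverts G" and b: "b \<in> pverts H"
  shows "closer W (f, v) (f(v := b), v)
    = card (pverts G) * card (pverts H) ^ (card (pverts G) - 1) * closer H (f v) b" (is ?A)
    and "closer W (f(v := b), v) (f, v)
    = card (pverts G) * card (pverts H) ^ (card (pverts G) - 1) * closer H b (f v)" (is ?B)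
proof -
  let ?f = "f(v := b)"
  have f': "?f \<in> VF"
    using f v b by (auto simp: PiE_iff extensional_def)
  \<comment> \<open>\<open>c g x\<close> is what both distances share; it does not involve
    \<open>b\<close>. Its defining equation is a premise, discharged by \<open>refl\<close> on use,
    so that the long expression is written once.\<close>
  have d: "gdist W (g, x) (f, v) = gdist H (g v) (f v) + c g x \<and>
        gdist W (g, x) (?f, v) = gdist H (g v) b + c g x"
    if "c = (\<lambda>g x. rho G (differ g f) x v + (\<Sum>y \<in> pverts G - {v}. gdist H (g y) (f y)))"
      "g \<in> VF" "x \<in> pverts G" for c g x
  proof -
    have "rho G (differ g ?f) x v = rho G (differ g f) x v"
      by (rule G.rho_cong_endpoint) auto
    moreover have "(\<Sum>y \<in> pverts G - {v}. gdist H (g y) (?f y)) = (\<Sum>y \<in> pverts G - {v}. gdist H (g y) (f y))"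
      by (rule sum.cong) auto
    ultimately show ?thesis
      using that gdist_wreath[OF that(2) f that(3) v] gdist_wreath[OF that(2) f' that(3) v]
        total_gdist_split[OF v, of g f] total_gdist_split[OF v, of g ?f] by simp
  qed
  \<comment> \<open>Only the value at \<open>v\<close> is constrained: the base vertex and the
    values at all other vertices are free.\<close>
  have count: "card {w \<in> pverts W. P (fst w v)}
      = card (pverts G) * card (pverts H) ^ (card (pverts G) - 1) * card {a \<in> pverts H. P a}" for P
  proof -
    have "{w \<in> pverts W. P (fst w v)} = {g \<in> VF. P (g v)} \<times> pverts G"
      by (auto simp: verts_W)
    then show ?thesis
      using card_PiE_coordinate[OF G.pair_finite_verts v H.pair_finite_verts, of P]
      by (simp add: card_cartesian_product)
  qed
  have "{w \<in> pverts W. gdist W w (f, v) < gdist W w (?f, v)}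
      = {w \<in> pverts W. gdist H (fst w v) (f v) < gdist H (fst w v) b}"
    using d[OF refl] by (auto simp: verts_W)
  then show ?A
    unfolding closer_def count[symmetric] by simp
  have "{w \<in> pverts W. gdist W w (?f, v) < gdist W w (f, v)}
      = {w \<in> pverts W. gdist H (fst w v) b < gdist H (fst w v) (f v)}"
    using d[OF refl] by (auto simp: verts_W)
  then show ?B
    unfolding closer_def count[symmetric] by simp
qed

lemma closer_base_arc:
  assumes f: "f \<in> VF" and v: "v \<in> pverts G" "v' \<in> pverts G"
  shows "closer W (f, v) (f, v')
    = (\<Sum>A \<in> Pow (pverts G). (card (pverts H) - 1) ^ card A * closer_rho G A v v')"
proof -
  let ?S = "\<lambda>A. {g \<in> VF. differ g f = A} \<times> {x \<in> pverts G. rho G A x v < rho G A x v'}"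
  have fin: "finite VF"
    by (simp add: finite_PiE)
  \<comment> \<open>The term \<open>total_gdist g f\<close> is the same for both ends, so the
    comparison depends on \<open>g\<close> only through \<open>differ g f\<close>; fixing that set
    leaves a product set.\<close>
  have "{w \<in> pverts W. gdist W w (f, v) < gdist W w (f, v')} = (\<Union>A \<in> Pow (pverts G). ?S A)"
  proof (rule set_eqI)
    fix w :: "('a \<Rightarrow> 'b) \<times> 'a"
    obtain g x where w: "w = (g, x)" by (cases w)
    show "w \<in> {w \<in> pverts W. gdist W w (f, v) < gdist W w (f, v')} \<longleftrightarrow> w \<in> (\<Union>A \<in> Pow (pverts G). ?S A)"
    proof (cases "g \<in> VF \<and> x \<in> pverts G")
      case True
      then show ?thesis
        using f v by (simp add: w verts_W gdist_wreath)
    next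
      case False
      then show ?thesis by (auto simp: w verts_W)
    qed
  qed
  then have "closer W (f, v) (f, v') = card (\<Union>A \<in> Pow (pverts G). ?S A)"
    by (simp add: closer_def)
  also have "\<dots> = (\<Sum>A \<in> Pow (pverts G). card (?S A))"
    by (rule card_UN_disjoint) (use fin in auto)
  also have "\<dots> = (\<Sum>A \<in> Pow (pverts G). (card (pverts H) - 1) ^ card A * closer_rho G A v v')"
    using f by (intro sum.cong) (auto simp: card_cartesian_product card_PiE_differing_on closer_rho_def)
  finally show ?thesis .
qed

section \<open>Sums over the two kinds of arcs\<close>

abbreviation fibre_arcs where
  "fibre_arcs \<equiv> (\<lambda>(v, f, b). ((f, v), (f(v := b), v))) `
     (SIGMA v : pverts G. SIGMA f : VF. {b. (f v, b) \<in> parcs H})"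

abbreviation base_arcs where
  "base_arcs \<equiv> (\<lambda>(f, v, v'). ((f, v), (f, v'))) ` (VF \<times> parcs G)"

lemma arcs_W: "parcs W = fibre_arcs \<union> base_arcs"
proof (rule set_eqI)
  fix a :: "(('a \<Rightarrow> 'b) \<times> 'a) \<times> (('a \<Rightarrow> 'b) \<times> 'a)"
  obtain f v f' v' where a: "a = ((f, v), (f', v'))" by (metis surj_pair)
  show "a \<in> parcs W \<longleftrightarrow> a \<in> fibre_arcs \<union> base_arcs"
  proof
    assume "a \<in> parcs W"
    then have fv: "f \<in> VF" "f' \<in> VF" "v \<in> pverts G"
      and or: "v = v' \<and> (\<forall>w \<in> pverts G. w \<noteq> v \<longrightarrow> f w = f' w) \<and> (f v, f' v) \<in> parcs H
        \<or> f = f' \<and> (v, v') \<in> parcs G"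
      unfolding a arcs_W_iff by auto
    from or show "a \<in> fibre_arcs \<union> base_arcs"
    proof
      assume H: "v = v' \<and> (\<forall>w \<in> pverts G. w \<noteq> v \<longrightarrow> f w = f' w) \<and> (f v, f' v) \<in> parcs H"
      have "f' = f(v := f' v)"
        using fv H by (intro ext) (metis PiE_arb fun_upd_apply)
      then have "a = (\<lambda>(v, f, b). ((f, v), (f(v := b), v))) (v, f, f' v)"
        using H a by simp
      moreover have "(v, f, f' v) \<in> (SIGMA v : pverts G. SIGMA f : VF. {b. (f v, b) \<in> parcs H})"
        using H fv by auto
      ultimately show ?thesis by blast
    next
      assume "f = f' \<and> (v, v') \<in> parcs G"
      then show ?thesis using fv a by (intro UnI2 image_eqI[of _ _ "(f, v, v')"]) auto
    qed
  next
    assume "a \<in> fibre_arcs \<union> base_arcs"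
    then show "a \<in> parcs W"
    proof
      assume "a \<in> fibre_arcs"
      then obtain b where b: "v' = v" "f' = f(v := b)" "v \<in> pverts G" "f \<in> VF" "(f v, b) \<in> parcs H"
        unfolding a by auto
      have "b \<in> pverts H" using H.in_arcsD2[OF b(5)] by simp
      then have "f' \<in> VF" using b by (auto simp: PiE_iff extensional_def)
      then show ?thesis using b unfolding a arcs_W_iff by auto
    next
      assume "a \<in> base_arcs"
      then have "f' = f" "f \<in> VF" "(v, v') \<in> parcs G" unfolding a by auto
      then show ?thesis
        using G.in_arcsD1[of v v'] G.in_arcsD2[of v v'] unfolding a arcs_W_iff by auto
    qed
  qed
qed

text \<open>With \<open>n\<close> and \<open>m\<close> the numbers of vertices, choosing
  \<open>v\<close> and the values off \<open>v\<close> gives the factor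
  \<open>n * m ^ (n - 1)\<close>, and the two counts of closer vertices give it twice more. What is
  left is a sum over the arcs of \<open>H\<close>, which is twice \<open>szeged H\<close>.\<close>

lemma sum_fibre_arcs:
  "(\<Sum>(x, y) \<in> fibre_arcs. closer W x y * closer W y x)
    = 2 * (card (pverts G) ^ 3 * card (pverts H) ^ (3 * card (pverts G) - 3) * szeged H)"
proof -
  let ?n = "card (pverts G)" and ?m = "card (pverts H)"
  let ?F = "\<lambda>a b. closer H a b * closer H b a"
  have inj: "inj_on (\<lambda>(v, f, b). ((f, v), (f(v := b), v)))
      (SIGMA v : pverts G. SIGMA f : VF. {b. (f v, b) \<in> parcs H})"
    by (auto simp: inj_on_def dest: fun_cong split: if_splits)
  have finH: "finite {b. (a, b) \<in> parcs H}" for a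
    by (rule finite_subset[of _ "snd ` parcs H"]) force+
  have finVF: "finite VF" by (simp add: finite_PiE)
  have "(\<Sum>(x, y) \<in> fibre_arcs. closer W x y * closer W y x)
     = (\<Sum>v \<in> pverts G. \<Sum>f \<in> VF. \<Sum>b | (f v, b) \<in> parcs H.
         closer W (f, v) (f(v := b), v) * closer W (f(v := b), v) (f, v))"
    using finH finVF
    by (subst sum.reindex[OF inj]) (simp add: sum.Sigma case_prod_unfold finite_SigmaI)
  also have "\<dots> = (\<Sum>v \<in> pverts G. \<Sum>f \<in> VF. \<Sum>b | (f v, b) \<in> parcs H. (?n * ?m ^ (?n - 1))\<^sup>2 * ?F (f v) b)"
  proof (intro sum.cong refl)
    fix v f b assume *: "v \<in> pverts G" "f \<in> VF" "b \<in> {b. (f v, b) \<in> parcs H}"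
    then have "b \<in> pverts H" using H.in_arcsD2[of "f v" b] by simp
    then show "closer W (f, v) (f(v := b), v) * closer W (f(v := b), v) (f, v)
        = (?n * ?m ^ (?n - 1))\<^sup>2 * ?F (f v) b"
      using closer_fibre_arc[OF *(2,1)] by (simp add: power2_eq_square)
  qed
  \<comment> \<open>The sum over \<open>b\<close> depends on \<open>f\<close> only through
    \<open>f v\<close>.\<close>
  also have "\<dots> = (\<Sum>v \<in> pverts G. ?m ^ (?n - 1) *
      (\<Sum>a \<in> pverts H. \<Sum>b | (a, b) \<in> parcs H. (?n * ?m ^ (?n - 1))\<^sup>2 * ?F a b))"
    by (intro sum.cong refl sum_PiE_coordinate) auto
  also have "\<dots> = ?n * ?m ^ (?n - 1) * (?n * ?m ^ (?n - 1))\<^sup>2 *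
      (\<Sum>a \<in> pverts H. \<Sum>b | (a, b) \<in> parcs H. ?F a b)"
    by (simp add: sum_distrib_left mult.assoc)
  also have "(\<Sum>a \<in> pverts H. \<Sum>b | (a, b) \<in> parcs H. ?F a b) = (\<Sum>(a, b) \<in> parcs H. ?F a b)"
  proof -
    have "(SIGMA a : pverts H. {b. (a, b) \<in> parcs H}) = parcs H"
      using H.in_arcsD1 by auto
    then show ?thesis
      using finH by (simp add: sum.Sigma)
  qed
  also have "\<dots> = 2 * szeged H" by (rule H.double_szeged[symmetric])
  also have "?n * ?m ^ (?n - 1) * (?n * ?m ^ (?n - 1))\<^sup>2 = ?n ^ 3 * ?m ^ (3 * ?n - 3)"
  proof -
    have "?n * ?m ^ (?n - 1) * (?n * ?m ^ (?n - 1))\<^sup>2 = ?n ^ 3 * (?m ^ (?n - 1)) ^ 3"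
      by (simp add: power2_eq_square power3_eq_cube)
    \<comment> \<open>Under truncated subtraction \<open>3 * (n - 1) = 3 * n - 3\<close> holds for
      \<open>n = 0\<close> as well.\<close>
    also have "(?m ^ (?n - 1)) ^ 3 = ?m ^ (3 * ?n - 3)"
      by (simp add: power_mult[symmetric] algebra_simps diff_mult_distrib)
    finally show ?thesis .
  qed
  finally show ?thesis by (simp only: mult.left_commute[of _ 2])
qed

lemma sum_base_arcs:
  assumes D: "orientation G D"
  shows "(\<Sum>(x, y) \<in> base_arcs. closer W x y * closer W y x)
    = 2 * (card (pverts H) ^ card (pverts G) * (\<Sum>A \<in> Pow (pverts G). \<Sum>B \<in> Pow (pverts G).
        (card (pverts H) - 1) ^ (card A + card B) * szeged_rho G D A B))"
proof -
  let ?n = "card (pverts G)" and ?m = "card (pverts H)"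
  let ?P = "Pow (pverts G)"
  let ?c = "\<lambda>u v. \<Sum>A \<in> ?P. (?m - 1) ^ card A * closer_rho G A u v"
  have inj: "inj_on (\<lambda>(f, v, v'). ((f, v), (f, v'))) (VF \<times> parcs G)"
    by (auto simp: inj_on_def)
  have "(\<Sum>(x, y) \<in> base_arcs. closer W x y * closer W y x)
      = (\<Sum>f \<in> VF. \<Sum>(u, v) \<in> parcs G. closer W (f, u) (f, v) * closer W (f, v) (f, u))"
    by (subst sum.reindex[OF inj]) (simp add: sum.cartesian_product case_prod_unfold)
  also have "\<dots> = (\<Sum>f \<in> VF. \<Sum>(u, v) \<in> parcs G. ?c u v * ?c v u)"
    using G.in_arcsD1 G.in_arcsD2 by (intro sum.cong refl) (auto simp: closer_base_arc)
  also have "\<dots> = ?m ^ ?n * (\<Sum>(u, v) \<in> parcs G. ?c u v * ?c v u)"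
    by (simp add: card_PiE)
  \<comment> \<open>The product \<open>?c u v * ?c v u\<close> is symmetric, so every orientation
    yields half of the sum over arcs, although a single \<open>szeged_rho G D A B\<close> may depend
    on \<open>D\<close>.\<close>
  also have "(\<Sum>(u, v) \<in> parcs G. ?c u v * ?c v u) = 2 * (\<Sum>(u, v) \<in> D. ?c u v * ?c v u)"
    by (rule G.sum_arcs_eq_double_sum_orientation[OF D]) (rule mult.commute)
  also have "(\<Sum>(u, v) \<in> D. ?c u v * ?c v u) = (\<Sum>(u, v) \<in> D. \<Sum>A \<in> ?P. \<Sum>B \<in> ?P.
      (?m - 1) ^ (card A + card B) * (szeged_n_rho G A {u, v} u * szeged_n_rho G B {u, v} v))"
  proof (intro sum.cong refl, clarify)
    fix u v assume "(u, v) \<in> D"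
    then have uv: "(u, v) \<in> parcs G" "(v, u) \<in> parcs G"
      using D G.pair_sym_arcs by (auto simp: orientation_def symmetric_def sym_def)
    have "szeged_n_rho G A {u, v} u = closer_rho G A u v"
      "szeged_n_rho G A {u, v} v = closer_rho G A v u" for A
      using G.szeged_n_edge(3)[OF uv(1)] G.szeged_n_edge(3)[OF uv(2)]
      by (simp_all add: closer_rho_def insert_commute)
    then show "?c u v * ?c v u = (\<Sum>A \<in> ?P. \<Sum>B \<in> ?P.
      (?m - 1) ^ (card A + card B) * (szeged_n_rho G A {u, v} u * szeged_n_rho G B {u, v} v))"
      by (simp add: sum_product power_add mult_ac)
  qed
  \<comment> \<open>Two exchanges of summation move the sum over \<open>D\<close> inside those over
    \<open>A\<close> and \<open>B\<close>.\<close>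
  also have "\<dots> = (\<Sum>A \<in> ?P. \<Sum>B \<in> ?P. (?m - 1) ^ (card A + card B) * szeged_rho G D A B)"
    unfolding szeged_rho_def sum_distrib_left case_prod_unfold
    by (subst sum.swap, rule sum.cong[OF refl], subst sum.swap, rule refl)
  finally show ?thesis by simp
qed

end

theorem theorem6p12:
  fixes G :: "'a pair_pre_digraph" and H :: "'b pair_pre_digraph"
    and D :: "'a rel" and n m :: nat
  assumes "pair_graph G" and "connected (with_proj G)"
    and "pair_graph H" and "connected (with_proj H)"
    and "card (pverts G) = n" and "card (pverts H) = m"
    and "orientation G D"
  shows "szeged (wreath G H) =
    n ^ 3 * m ^ (3 * n - 3) * szeged H
    + m ^ n * (\<Sum>A \<in> Pow (pverts G). \<Sum>B \<in> Pow (pverts G).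
        (m - 1) ^ (card A + card B) * szeged_rho G D A B)"
proof -
  interpret wreath_graphs G H
    using assms(1-4)
    by (auto simp: wreath_graphs_def connected_graph_def connected_graph_axioms_def)
  \<comment> \<open>A fibre arc keeps the base vertex, while a base arc moves it along an arc of
    \<open>G\<close>, which is never a loop.\<close>
  have "fibre_arcs \<inter> base_arcs = {}"
    by (auto dest: G.pair_no_loops)
  moreover have "finite fibre_arcs" "finite base_arcs"
    using W.pair_finite_arcs unfolding arcs_W by simp_all
  ultimately have "2 * szeged (wreath G H)
      = (\<Sum>(x, y) \<in> fibre_arcs. closer W x y * closer W y x)
      + (\<Sum>(x, y) \<in> base_arcs. closer W x y * closer W y x)"
    unfolding W.double_szeged unfolding arcs_W by (intro sum.union_disjoint)
  \<comment> \<open>Both sums carry the factor 2, which cancels.\<close>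
  then show ?thesis
    unfolding sum_fibre_arcs sum_base_arcs[OF assms(7)] assms(5,6) by simp
qed

end
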